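(* Consider the adjacency-list model augmented with $\texttt{JUMP}$, $\texttt{IN-SORTED}$ and $\texttt{ADJ}$. For any $n$ and $m$ with $n\le m\le n^2$ and any $\delta\in(0,1]$, there exists a directed graph $G=(V,E)$ with $\Theta(n)$ nodes and $\Theta(m)$ edges such that for any algorithm solving the single-target problem, the expected running time on $G$ with approximation threshold $\delta$, averaged over all targets $t\in V$, is $\Omega(\min\{m,1/\delta\})$.
   Context: Fix a constant $\alpha\in(0,1)$. For a directed graph $G=(V,E)$, an $\alpha$-discounted random walk from $s$: at each step, with probability $\alpha$ it terminates at the current node, otherwise it moves to a uniformly random out-neighbor of the current node. $\pi(s,t)$ is the probability that such a walk from $s$ terminates at $t$. Adjacency-list model: an algorithm accesses $G$ only through constant-time queries $\texttt{DEG-IN}(u)$, $\texttt{DEG-OUT}(u)$ (in-/out-degree of $u$), $\texttt{IN}(u,i)$, $\texttt{OUT}(u,i)$ ($i$-th in-/out-neighbor of $u$). Additional queries: $\texttt{ADJ}(u,v)$ returns whether $(u,v)\in E$; $\texttt{IN-SORTED}(u,i)$ returns the $i$-th in-neighbor of $u$ when in-neighbors are sorted by out-degree; $\texttt{JUMP}()$ returns a uniformly random node of $V$. Single-target problem: given $G$ (via queries), a target $t\in V$ and $\delta\in(0,1]$, output estimates $\hat\pi(s,t)$ for all $s\in V$ such that for each $s$, $\Pr\{|\hat\pi(s,t)-\pi(s,t)|\ge\varepsilon\max\{\pi(s,t),\delta\}\}\le p_f$, where $\varepsilon,p_f$ are fixed small constants; an algorithm solves the problem if this holds for every input. *)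

theory Defs
  imports "HOL-Probability.Probability" "Graph_Theory.Pair_Digraph"
begin

text \<open>Every node needs an out-neighbor for the discounted walk to be well defined.
  Self-loops are allowed.\<close>

definition input_graph :: "nat pair_pre_digraph \<Rightarrow> bool" where
  "input_graph G \<longleftrightarrow> pair_fin_digraph G \<and> (\<forall>u\<in>pverts G. parcs G `` {u} \<noteq> {})"

partial_function (spmf) discounted_walk :: "real \<Rightarrow> nat pair_pre_digraph \<Rightarrow> nat \<Rightarrow> nat spmf" where
  "discounted_walk \<alpha> G v =
     bind_spmf (spmf_of_pmf (bernoulli_pmf \<alpha>)) (\<lambda>stop.
       if stop then return_spmf v
       else bind_spmf (spmf_of_set (parcs G `` {v})) (\<lambda>u. discounted_walk \<alpha> G u))"

definition ppr :: "real \<Rightarrow> nat pair_pre_digraph \<Rightarrow> nat \<Rightarrow> nat \<Rightarrow> real" where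
  "ppr \<alpha> G s t = spmf (discounted_walk \<alpha> G s) t"


text \<open>The order of the lists for IN and OUT, and the order among in-neighbors of equal
  out-degree for IN-SORTED, belong to the presentation of the graph and are arbitrary.\<close>

record adj_lists =
  out_list :: "nat \<Rightarrow> nat list"
  in_list :: "nat \<Rightarrow> nat list"
  in_sorted_list :: "nat \<Rightarrow> nat list"

definition adj_lists_of :: "nat pair_pre_digraph \<Rightarrow> adj_lists \<Rightarrow> bool" where
  "adj_lists_of G L \<longleftrightarrow> (\<forall>u\<in>pverts G.
     distinct (out_list L u) \<and> set (out_list L u) = parcs G `` {u} \<and>
     distinct (in_list L u) \<and> set (in_list L u) = (parcs G)\<inverse> `` {u} \<and>
     distinct (in_sorted_list L u) \<and> set (in_sorted_list L u) = (parcs G)\<inverse> `` {u} \<and>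
     sorted (map (out_degree (with_proj G)) (in_sorted_list L u)))"

datatype query =
    Deg_In nat | Deg_Out nat | In nat nat | Out nat nat
  | Adj nat nat | In_Sorted nat nat | Jump

datatype answer = Number nat | Node nat | Truth bool | Invalid

definition list_answer :: "nat pair_pre_digraph \<Rightarrow> (nat \<Rightarrow> nat list) \<Rightarrow> nat \<Rightarrow> nat \<Rightarrow> answer" where
  "list_answer G l u i = (if u \<in> pverts G \<and> i < length (l u) then Node (l u ! i) else Invalid)"

fun answer_query :: "nat pair_pre_digraph \<Rightarrow> adj_lists \<Rightarrow> query \<Rightarrow> answer pmf" where
  "answer_query G L (Deg_In u) =
     return_pmf (if u \<in> pverts G then Number (in_degree (with_proj G) u) else Invalid)"
| "answer_query G L (Deg_Out u) =
     return_pmf (if u \<in> pverts G then Number (out_degree (with_proj G) u) else Invalid)"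
| "answer_query G L (In u i) = return_pmf (list_answer G (in_list L) u i)"
| "answer_query G L (Out u i) = return_pmf (list_answer G (out_list L) u i)"
| "answer_query G L (Adj u v) = return_pmf (Truth ((u, v) \<in> parcs G))"
| "answer_query G L (In_Sorted u i) = return_pmf (list_answer G (in_sorted_list L) u i)"
| "answer_query G L Jump = map_pmf Node (pmf_of_set (pverts G))"


text \<open>A computation is a possibly infinite tree of elementary steps, each taking one unit of
  time: halting with an output, a query whose answer selects the continuation, or an internal
  step, which may be randomized (a deterministic one uses a point distribution).  Arbitrary
  continuations are allowed, so every uniform algorithm is covered.  The second component of the
  result of \<open>exec\<close> is the running time; the mass missing from the subdistribution is the
  probability of running forever.\<close>

codatatype 'o comp =
    Halt 'o
  | Query query "answer \<Rightarrow> 'o comp"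
  | Internal "'o comp pmf"

partial_function (spmf) exec ::
  "nat pair_pre_digraph \<Rightarrow> adj_lists \<Rightarrow> 'o comp \<Rightarrow> ('o \<times> nat) spmf" where
  "exec G L c = (case c of
       Halt x \<Rightarrow> return_spmf (x, 1)
     | Query q f \<Rightarrow> bind_spmf (spmf_of_pmf (answer_query G L q))
         (\<lambda>a. map_spmf (map_prod id Suc) (exec G L (f a)))
     | Internal p \<Rightarrow> bind_spmf (spmf_of_pmf p)
         (\<lambda>c'. map_spmf (map_prod id Suc) (exec G L c')))"

text \<open>The arguments of an algorithm are the node set, the number of edges, the target and the
  threshold; its output is the vector of estimates.\<close>

type_synonym algorithm = "nat set \<Rightarrow> nat \<Rightarrow> nat \<Rightarrow> real \<Rightarrow> (nat \<Rightarrow> real) comp"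

definition exec_algorithm ::
  "algorithm \<Rightarrow> nat pair_pre_digraph \<Rightarrow> adj_lists \<Rightarrow> nat \<Rightarrow> real \<Rightarrow> ((nat \<Rightarrow> real) \<times> nat) spmf" where
  "exec_algorithm A G L t \<delta> = exec G L (A (pverts G) (card (parcs G)) t \<delta>)"

text \<open>A run without output, i.e. \<open>None\<close>, counts as a failure for every \<open>s\<close>.\<close>

definition solves_single_target :: "real \<Rightarrow> real \<Rightarrow> real \<Rightarrow> algorithm \<Rightarrow> bool" where
  "solves_single_target \<alpha> \<epsilon> p\<^sub>f A \<longleftrightarrow>
     (\<forall>G L. input_graph G \<and> adj_lists_of G L \<longrightarrow>
       (\<forall>t\<in>pverts G. \<forall>\<delta>. 0 < \<delta> \<and> \<delta> \<le> 1 \<longrightarrow>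
         (\<forall>s\<in>pverts G.
           measure_pmf.prob (exec_algorithm A G L t \<delta>)
             {r. case r of None \<Rightarrow> True
                 | Some (est, _) \<Rightarrow>
                     \<bar>est s - ppr \<alpha> G s t\<bar> \<ge> \<epsilon> * max (ppr \<alpha> G s t) \<delta>} \<le> p\<^sub>f)))"

definition expected_time ::
  "algorithm \<Rightarrow> nat pair_pre_digraph \<Rightarrow> adj_lists \<Rightarrow> nat \<Rightarrow> real \<Rightarrow> ennreal" where
  "expected_time A G L t \<delta> =
     (\<integral>\<^sup>+ r. (case r of None \<Rightarrow> \<infinity> | Some (_, k) \<Rightarrow> of_nat k)
        \<partial>measure_pmf (exec_algorithm A G L t \<delta>))"

definition average_expected_time ::
  "algorithm \<Rightarrow> nat pair_pre_digraph \<Rightarrow> adj_lists \<Rightarrow> real \<Rightarrow> ennreal" where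
  "average_expected_time A G L \<delta> =
     (\<Sum>t\<in>pverts G. expected_time A G L t \<delta>) / of_nat (card (pverts G))"

end

theory Submission
  imports Defs
begin

text \<open>Disjoint groups of targets are each reached from \<open>b\<close> sources through \<open>k\<close> relays by complete
  bipartite graphs, and \<open>b\<close> further sources lead to \<open>k\<close> dead ends; here \<open>b * k\<close> is of the order of
  \<open>min m (1 / \<delta>)\<close>.  Exchanging the heads of an edge from source \<open>i\<close> to relay \<open>j\<close> and of the edge
  from the further source \<open>i\<close> to the dead end \<open>j\<close> raises the value of the latter source from \<open>0\<close>
  to \<open>\<alpha> * (1 - \<alpha>)\<^sup>2 / (b * k)\<close>, which the algorithm must notice.  All degrees are preserved, so a
  query notices the exchange only if it inspects one of the four pairs of nodes involved, and these
  pairs are disjoint for different \<open>(i, j)\<close>.  Hence on the unmodified graph the expected number of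
  queries is at least a constant times \<open>b * k\<close>.\<close>

section \<open>Expectations over runs and indistinguishable instances\<close>

text \<open>The chain need not be a sequence, but the support of the limit is countable, and on a
  countable space monotone convergence holds for arbitrary chains. This gives admissibility in the
  fixpoint induction on \<open>exec\<close>.\<close>

lemma nn_integral_lub_spmf:
  fixes h :: "'a \<Rightarrow> ennreal"
  assumes chain: "Complete_Partial_Order.chain (ord_spmf (=)) Y" and Y: "Y \<noteq> {}"
  shows "(\<integral>\<^sup>+ x. h x \<partial>measure_spmf (lub_spmf Y)) = (SUP p\<in>Y. \<integral>\<^sup>+ x. h x \<partial>measure_spmf p)"
proof -
  let ?M = "count_space (set_spmf (lub_spmf Y))"
  have "(\<integral>\<^sup>+ x. h x \<partial>measure_spmf (lub_spmf Y)) = (\<integral>\<^sup>+ x. ennreal (spmf (lub_spmf Y) x) * h x \<partial>?M)"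
    by (rule nn_integral_measure_spmf')
  also have "\<dots> = (\<integral>\<^sup>+ x. (SUP p\<in>Y. ennreal (spmf p x) * h x) \<partial>?M)"
    by (simp add: ennreal_spmf_lub_spmf[OF chain Y] SUP_mult_right_ennreal)
  also have "\<dots> = (SUP p\<in>Y. \<integral>\<^sup>+ x. ennreal (spmf p x) * h x \<partial>?M)"
  proof (rule nn_integral_monotone_convergence_SUP_countable[OF Y])
    show "Complete_Partial_Order.chain (\<le>) ((\<lambda>p x. ennreal (spmf p x) * h x) ` Y)"
      using chain
      by (rule chain_imageI) (auto simp: le_fun_def intro!: mult_right_mono dest: ord_spmf_eq_leD)
  qed simp
  also have "\<dots> = (SUP p\<in>Y. \<integral>\<^sup>+ x. h x \<partial>measure_spmf p)"
    by (auto simp: nn_integral_measure_spmf nn_integral_count_space_indicator set_lub_spmf[OF chain]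
        spmf_eq_0_set_spmf split: split_indicator intro!: SUP_cong nn_integral_cong)
  finally show ?thesis .
qed

text \<open>The left side has the shape of one unfolding of \<open>exec\<close>, with
  \<open>g\<close> charging the unit of time.\<close>

lemma nn_integral_bind_map_spmf:
  fixes h :: "'c \<Rightarrow> ennreal"
  shows "(\<integral>\<^sup>+ y. h y \<partial>measure_spmf (bind_pmf p (\<lambda>a. map_spmf g (f a))))
    = (\<integral>\<^sup>+ a. (\<integral>\<^sup>+ x. h (g x) \<partial>measure_spmf (f a)) \<partial>measure_pmf p)"
  by (simp add: measure_spmf_bind_pmf o_def)
     (subst nn_integral_bind[where B="count_space UNIV"]; simp add: o_def)

text \<open>A query that tells \<open>G\<close> apart from at most one of the instances \<open>H s\<close> separates the two sides
  by at most the mass of the runs making it, which is also what it adds to the running time.\<close>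

lemma exec_distinguish:
  fixes B :: "'i \<Rightarrow> 'o set" and c :: "'o comp"
  assumes fin: "finite S"
    and one: "\<And>q. card {s\<in>S. answer_query (H s) (M s) q \<noteq> answer_query G L q} \<le> 1"
  shows "(\<Sum>s\<in>S. \<integral>\<^sup>+ r. indicator (B s) (fst r) \<partial>measure_spmf (exec G L c))
    \<le> (\<Sum>s\<in>S. \<integral>\<^sup>+ r. indicator (B s) (fst r) \<partial>measure_spmf (exec (H s) (M s) c))
      + (\<integral>\<^sup>+ r. of_nat (snd r) \<partial>measure_spmf (exec G L c))"
proof -
  define hit :: "'i \<Rightarrow> 'o \<times> nat \<Rightarrow> ennreal" where "hit s r = indicator (B s) (fst r)" for s r
  define time :: "'o \<times> nat \<Rightarrow> ennreal" where "time r = of_nat (snd r)" for r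
  define E where "E s c = (\<integral>\<^sup>+ r. hit s r \<partial>measure_spmf (exec (H s) (M s) c))" for s c
  have hit_Suc: "hit s (map_prod id Suc r) = hit s r" for s r by (simp add: hit_def)
  have time_Suc: "time (map_prod id Suc r) = 1 + time r" for r by (simp add: time_def)
  have hit_le: "hit s r \<le> 1" for s r by (simp add: hit_def split: split_indicator)
  have E_Halt: "E s (Halt x) = hit s (x, 1)" for s x
    unfolding E_def by (subst exec.simps) (simp add: measure_spmf_return_spmf nn_integral_return)
  have E_Query: "E s (Query q f) = (\<integral>\<^sup>+ a. E s (f a) \<partial>measure_pmf (answer_query (H s) (M s) q))"
    for s q f
    unfolding E_def by (subst exec.simps) (simp add: nn_integral_bind_map_spmf hit_Suc)
  have E_Internal: "E s (Internal p) = (\<integral>\<^sup>+ c. E s c \<partial>measure_pmf p)" for s p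
    unfolding E_def by (subst exec.simps) (simp add: nn_integral_bind_map_spmf hit_Suc)
  \<comment> \<open>The induction approximates the run on \<open>G\<close> only; the runs on the
    \<open>H s\<close> stay complete inside \<open>E\<close>. The set \<open>S'\<close> has to vary
    because an instance that a query separates is dropped from the rest of the run.\<close>
  have "\<forall>c S'. S' \<subseteq> S \<longrightarrow>
      (\<integral>\<^sup>+ r. (\<Sum>s\<in>S'. hit s r) \<partial>measure_spmf (exec G L c))
      \<le> (\<Sum>s\<in>S'. E s c) + (\<integral>\<^sup>+ r. time r \<partial>measure_spmf (exec G L c))"
  proof (induction rule: exec.fixp_induct)
    case 1
    show ?case
    proof (rule ccpo.admissibleI, intro allI impI)
      fix A :: "((nat pair_pre_digraph \<times> adj_lists) \<times> 'o comp \<Rightarrow> ('o \<times> nat) spmf) set"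
      fix c :: "'o comp" and S'
      assume chain: "Complete_Partial_Order.chain spmf.le_fun A" and "A \<noteq> {}" "S' \<subseteq> S"
        and IH: "\<forall>F\<in>A. \<forall>c S'. S' \<subseteq> S \<longrightarrow>
          (\<integral>\<^sup>+ r. (\<Sum>s\<in>S'. hit s r) \<partial>measure_spmf (curry (curry F) G L c))
          \<le> (\<Sum>s\<in>S'. E s c) + (\<integral>\<^sup>+ r. time r \<partial>measure_spmf (curry (curry F) G L c))"
      let ?Y = "{y. \<exists>F\<in>A. y = F ((G, L), c)}"
      have Y: "Complete_Partial_Order.chain (ord_spmf (=)) ?Y" "?Y \<noteq> {}"
        using chain \<open>A \<noteq> {}\<close> by (auto intro: chain_fun)
      have "(SUP p\<in>?Y. \<integral>\<^sup>+ r. (\<Sum>s\<in>S'. hit s r) \<partial>measure_spmf p)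
        \<le> (\<Sum>s\<in>S'. E s c) + (SUP p\<in>?Y. \<integral>\<^sup>+ r. time r \<partial>measure_spmf p)"
      proof (rule SUP_least)
        fix p assume p: "p \<in> ?Y"
        then have "(\<integral>\<^sup>+ r. (\<Sum>s\<in>S'. hit s r) \<partial>measure_spmf p)
          \<le> (\<Sum>s\<in>S'. E s c) + (\<integral>\<^sup>+ r. time r \<partial>measure_spmf p)"
          using IH \<open>S' \<subseteq> S\<close> by auto
        also have "\<dots> \<le> (\<Sum>s\<in>S'. E s c) + (SUP p\<in>?Y. \<integral>\<^sup>+ r. time r \<partial>measure_spmf p)"
          using p by (intro add_left_mono SUP_upper)
        finally show "(\<integral>\<^sup>+ r. (\<Sum>s\<in>S'. hit s r) \<partial>measure_spmf p) \<le> \<dots>" .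
      qed
      then show "(\<integral>\<^sup>+ r. (\<Sum>s\<in>S'. hit s r) \<partial>measure_spmf (curry (curry (spmf.lub_fun A)) G L c))
          \<le> (\<Sum>s\<in>S'. E s c) + (\<integral>\<^sup>+ r. time r \<partial>measure_spmf (curry (curry (spmf.lub_fun A)) G L c))"
        by (simp add: fun_lub_def nn_integral_lub_spmf[OF Y])
    qed
  next
    case 2
    show ?case by simp
  next
    case (3 F)
    show ?case
    proof (intro allI impI)
      fix c :: "'o comp" and S' assume S': "S' \<subseteq> S"
      then have fin': "finite S'" using fin finite_subset by blast
      show "(\<integral>\<^sup>+ r. (\<Sum>s\<in>S'. hit s r) \<partial>measure_spmf
          (case c of Halt x \<Rightarrow> return_spmf (x, 1)
            | Query q f \<Rightarrow> bind_spmf (spmf_of_pmf (answer_query G L q))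
                (\<lambda>a. map_spmf (map_prod id Suc) (F G L (f a)))
            | Internal p \<Rightarrow> bind_spmf (spmf_of_pmf p)
                (\<lambda>c'. map_spmf (map_prod id Suc) (F G L c'))))
        \<le> (\<Sum>s\<in>S'. E s c) + (\<integral>\<^sup>+ r. time r \<partial>measure_spmf
          (case c of Halt x \<Rightarrow> return_spmf (x, 1)
            | Query q f \<Rightarrow> bind_spmf (spmf_of_pmf (answer_query G L q))
                (\<lambda>a. map_spmf (map_prod id Suc) (F G L (f a)))
            | Internal p \<Rightarrow> bind_spmf (spmf_of_pmf p)
                (\<lambda>c'. map_spmf (map_prod id Suc) (F G L c'))))"
      proof (cases c)
        case (Halt x)
        then show ?thesis by (simp add: E_Halt measure_spmf_return_spmf nn_integral_return)
      next
        case (Internal p)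
        have "(\<integral>\<^sup>+ c. (\<integral>\<^sup>+ r. (\<Sum>s\<in>S'. hit s r) \<partial>measure_spmf (F G L c)) \<partial>measure_pmf p)
          \<le> (\<integral>\<^sup>+ c. ((\<Sum>s\<in>S'. E s c) + (\<integral>\<^sup>+ r. 1 + time r \<partial>measure_spmf (F G L c))) \<partial>measure_pmf p)"
        proof (rule nn_integral_mono)
          fix c
          have "(\<integral>\<^sup>+ r. (\<Sum>s\<in>S'. hit s r) \<partial>measure_spmf (F G L c))
            \<le> (\<Sum>s\<in>S'. E s c) + (\<integral>\<^sup>+ r. time r \<partial>measure_spmf (F G L c))"
            using 3 S' by blast
          also have "\<dots> \<le> (\<Sum>s\<in>S'. E s c) + (\<integral>\<^sup>+ r. 1 + time r \<partial>measure_spmf (F G L c))"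
            by (intro add_left_mono nn_integral_mono) simp
          finally show "(\<integral>\<^sup>+ r. (\<Sum>s\<in>S'. hit s r) \<partial>measure_spmf (F G L c)) \<le> \<dots>" .
        qed
        also have "\<dots> = (\<Sum>s\<in>S'. E s (Internal p))
            + (\<integral>\<^sup>+ c. (\<integral>\<^sup>+ r. 1 + time r \<partial>measure_spmf (F G L c)) \<partial>measure_pmf p)"
          by (simp add: nn_integral_add nn_integral_sum E_Internal)
        finally show ?thesis
          by (simp add: Internal nn_integral_bind_map_spmf hit_Suc time_Suc)
      next
        case (Query q f)
        \<comment> \<open>These are the instances separated by this query. There is at most one, so
          giving up its hits costs at most one unit per halting run, which the time of the query
          pays for.\<close>
        define N where "N = {s\<in>S'. answer_query (H s) (M s) q \<noteq> answer_query G L q}"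
        have N: "N \<subseteq> S'" "finite N" using fin' by (auto simp: N_def)
        have "card N \<le> card {s\<in>S. answer_query (H s) (M s) q \<noteq> answer_query G L q}"
          using S' fin by (intro card_mono) (auto simp: N_def)
        then have N1: "card N \<le> 1" using one[of q] by linarith
        have hit_N: "(\<Sum>s\<in>N. hit s r) \<le> 1" for r
        proof -
          have "(\<Sum>s\<in>N. hit s r) \<le> (\<Sum>s\<in>N. 1)" by (intro sum_mono hit_le)
          also have "\<dots> \<le> 1" using N1 by simp
          finally show ?thesis .
        qed
        have "(\<integral>\<^sup>+ a. (\<integral>\<^sup>+ r. (\<Sum>s\<in>S'. hit s r) \<partial>measure_spmf (F G L (f a))) \<partial>measure_pmf (answer_query G L q))
          \<le> (\<integral>\<^sup>+ a. ((\<Sum>s\<in>S' - N. E s (f a)) + (\<integral>\<^sup>+ r. 1 + time r \<partial>measure_spmf (F G L (f a))))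
              \<partial>measure_pmf (answer_query G L q))"
        proof (rule nn_integral_mono)
          fix a
          have "(\<integral>\<^sup>+ r. (\<Sum>s\<in>S'. hit s r) \<partial>measure_spmf (F G L (f a)))
            = (\<integral>\<^sup>+ r. (\<Sum>s\<in>S' - N. hit s r) + (\<Sum>s\<in>N. hit s r) \<partial>measure_spmf (F G L (f a)))"
            using N fin' by (simp add: sum.subset_diff[of N S'])
          also have "\<dots> \<le> (\<integral>\<^sup>+ r. (\<Sum>s\<in>S' - N. hit s r) + 1 \<partial>measure_spmf (F G L (f a)))"
            by (intro nn_integral_mono add_left_mono hit_N)
          also have "\<dots> = (\<integral>\<^sup>+ r. (\<Sum>s\<in>S' - N. hit s r) \<partial>measure_spmf (F G L (f a)))
              + (\<integral>\<^sup>+ r. 1 \<partial>measure_spmf (F G L (f a)))"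
            by (simp add: nn_integral_add)
          also have "\<dots> \<le> ((\<Sum>s\<in>S' - N. E s (f a)) + (\<integral>\<^sup>+ r. time r \<partial>measure_spmf (F G L (f a))))
              + (\<integral>\<^sup>+ r. 1 \<partial>measure_spmf (F G L (f a)))"
            using 3 S' by (intro add_right_mono) blast
          also have "\<dots> = (\<Sum>s\<in>S' - N. E s (f a)) + (\<integral>\<^sup>+ r. 1 + time r \<partial>measure_spmf (F G L (f a)))"
            by (simp add: nn_integral_add ac_simps)
          finally show "(\<integral>\<^sup>+ r. (\<Sum>s\<in>S'. hit s r) \<partial>measure_spmf (F G L (f a))) \<le> \<dots>" .
        qed
        also have "\<dots> = (\<Sum>s\<in>S' - N. \<integral>\<^sup>+ a. E s (f a) \<partial>measure_pmf (answer_query G L q))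
            + (\<integral>\<^sup>+ a. (\<integral>\<^sup>+ r. 1 + time r \<partial>measure_spmf (F G L (f a))) \<partial>measure_pmf (answer_query G L q))"
          by (simp add: nn_integral_add nn_integral_sum)
        \<comment> \<open>Outside \<open>N\<close> the answer has the same distribution on
          \<open>H s\<close> as on \<open>G\<close>, so averaging over the answers of
          \<open>G\<close> yields the run on \<open>H s\<close>.\<close>
        also have "(\<Sum>s\<in>S' - N. \<integral>\<^sup>+ a. E s (f a) \<partial>measure_pmf (answer_query G L q))
            = (\<Sum>s\<in>S' - N. E s (Query q f))"
          by (rule sum.cong) (auto simp: E_Query N_def)
        also have "\<dots> \<le> (\<Sum>s\<in>S'. E s (Query q f))"
          using fin' by (intro sum_mono2) auto
        finally show ?thesis
          by (simp add: Query nn_integral_bind_map_spmf hit_Suc time_Suc add_right_mono)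
      qed
    qed
  qed
  then show ?thesis
    by (simp add: nn_integral_sum E_def hit_def time_def)
qed

section \<open>First-step analysis of the discounted walk\<close>

lemma ppr_unfold:
  assumes "0 \<le> \<alpha>" "\<alpha> \<le> 1" "finite (parcs G `` {s})" "parcs G `` {s} \<noteq> {}"
  shows "ppr \<alpha> G s t = \<alpha> * of_bool (s = t)
    + (1 - \<alpha>) * (\<Sum>u\<in>parcs G `` {s}. ppr \<alpha> G u t) / card (parcs G `` {s})"
  unfolding ppr_def using assms
  by (subst discounted_walk.simps)
     (simp add: spmf_bind pmf_bind measure_spmf_spmf_of_set integral_pmf_of_set)

lemma ppr_nonneg: "0 \<le> ppr \<alpha> G s t"
  by (simp add: ppr_def)

lemma ppr_self_ge:
  assumes "0 \<le> \<alpha>" "\<alpha> \<le> 1" "finite (parcs G `` {s})" "parcs G `` {s} \<noteq> {}"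
  shows "\<alpha> \<le> ppr \<alpha> G s s"
  using assms by (simp add: ppr_unfold sum_nonneg ppr_nonneg)

lemma ppr_step_ge:
  assumes "0 \<le> \<alpha>" "\<alpha> \<le> 1" "finite (parcs G `` {s})" "(s, u) \<in> parcs G"
  shows "(1 - \<alpha>) * ppr \<alpha> G u t / card (parcs G `` {s}) \<le> ppr \<alpha> G s t"
proof -
  have "ppr \<alpha> G u t \<le> (\<Sum>u\<in>parcs G `` {s}. ppr \<alpha> G u t)"
    using assms by (intro member_le_sum) (auto simp: ppr_nonneg)
  then have "(1 - \<alpha>) * ppr \<alpha> G u t / card (parcs G `` {s})
      \<le> (1 - \<alpha>) * (\<Sum>u\<in>parcs G `` {s}. ppr \<alpha> G u t) / card (parcs G `` {s})"
    using assms by (intro divide_right_mono mult_left_mono) auto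
  also have "\<dots> \<le> ppr \<alpha> G s t"
    using assms by (subst ppr_unfold) auto
  finally show ?thesis .
qed

text \<open>The first step gives \<pi> = (1 - \<alpha>) \<pi>, which forces \<pi> = 0 because
  \<alpha> is positive.\<close>

lemma ppr_loop_eq_0:
  assumes "0 < \<alpha>" "\<alpha> \<le> 1" "parcs G `` {v} = {v}" "v \<noteq> t"
  shows "ppr \<alpha> G v t = 0"
proof -
  have "ppr \<alpha> G v t = (1 - \<alpha>) * ppr \<alpha> G v t"
    using ppr_unfold[of \<alpha> G v t] assms by simp
  then show ?thesis using assms(1) by (simp add: algebra_simps)
qed

section \<open>Exchanging the heads of two arcs\<close>

lemma out_degree_with_proj: "out_degree (with_proj G) a = card (parcs G `` {a})"
proof -
  have "out_arcs (with_proj G) a = Pair a ` (parcs G `` {a})"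
    by (auto simp: out_arcs_def)
  then show ?thesis by (simp add: out_degree_def card_image inj_on_def)
qed

lemma in_degree_with_proj: "in_degree (with_proj G) a = card ((parcs G)\<inverse> `` {a})"
proof -
  have "in_arcs (with_proj G) a = (\<lambda>b. (b, a)) ` ((parcs G)\<inverse> `` {a})"
    by (auto simp: in_arcs_def)
  then show ?thesis by (simp add: in_degree_def card_image inj_on_def)
qed

text \<open>The two absent arcs are the ones to be created, so the exchange produces no duplicate
  and keeps the number of arcs. Together with the present arcs they force
  \<open>x \<noteq> u\<close> and \<open>w \<noteq> v\<close>.\<close>

locale arc_swap =
  fixes G :: "nat pair_pre_digraph" and L :: adj_lists and x w u v :: nat
  assumes arcs: "(x, w) \<in> parcs G" "(u, v) \<in> parcs G"
    and non_arcs: "(x, v) \<notin> parcs G" "(u, w) \<notin> parcs G"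
begin

abbreviation swap_head :: "nat \<Rightarrow> nat" where "swap_head \<equiv> Transposition.transpose w v"
abbreviation swap_tail :: "nat \<Rightarrow> nat" where "swap_tail \<equiv> Transposition.transpose x u"

definition G' :: "nat pair_pre_digraph" where
  "G' = \<lparr>pverts = pverts G, parcs = parcs G - {(x, w), (u, v)} \<union> {(x, v), (u, w)}\<rparr>"

text \<open>Each new neighbor takes the list position of the one it replaces, so that all other
  positions answer as before.\<close>

definition L' :: adj_lists where
  "L' = \<lparr>out_list = (\<lambda>a. if a \<in> {x, u} then map swap_head (out_list L a) else out_list L a),
         in_list = (\<lambda>a. if a \<in> {w, v} then map swap_tail (in_list L a) else in_list L a),
         in_sorted_list =
           (\<lambda>a. if a \<in> {w, v} then map swap_tail (in_sorted_list L a) else in_sorted_list L a)\<rparr>"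

lemma pverts_G' [simp]: "pverts G' = pverts G"
  by (simp add: G'_def)

lemma neq: "x \<noteq> u" "w \<noteq> v"
  using arcs non_arcs by auto

text \<open>Exactly one of \<open>w\<close> and \<open>v\<close> is an out-neighbor of
  \<open>x\<close>, and the other one of \<open>u\<close>, so transposing them performs the
  exchange. Written as an image under a bijection, the neighborhood visibly keeps its size and
  matches the mapped lists in \<open>L'\<close>.\<close>

lemma out_G': "parcs G' `` {a} = (if a \<in> {x, u} then swap_head ` (parcs G `` {a}) else parcs G `` {a})"
  using arcs non_arcs neq
  by (auto simp: G'_def Transposition.transpose_def image_iff split: if_splits)

lemma in_G': "(parcs G')\<inverse> `` {a}
    = (if a \<in> {w, v} then swap_tail ` ((parcs G)\<inverse> `` {a}) else (parcs G)\<inverse> `` {a})"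
  using arcs non_arcs neq
  by (auto simp: G'_def Transposition.transpose_def image_iff split: if_splits)

lemma card_out_G': "card (parcs G' `` {a}) = card (parcs G `` {a})"
  by (simp add: out_G' card_image)

lemma card_in_G': "card ((parcs G')\<inverse> `` {a}) = card ((parcs G)\<inverse> `` {a})"
  by (simp add: in_G' card_image)

text \<open>The number of arcs is an argument of the algorithm, so the swap must not reveal itself
  through it.\<close>

lemma card_parcs_G':
  assumes "finite (parcs G)"
  shows "card (parcs G') = card (parcs G)"
proof -
  let ?A = "{(x, w), (u, v)}" and ?B = "{(x, v), (u, w)}"
  have sub: "?A \<subseteq> parcs G" and disj: "(parcs G - ?A) \<inter> ?B = {}" and "card ?A = card ?B"
    using arcs non_arcs neq by auto
  have "card (parcs G') = card (parcs G - ?A) + card ?B"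
    unfolding G'_def using assms disj by (simp add: card_Un_disjoint del: Un_insert_right)
  then show ?thesis
    using sub assms \<open>card ?A = card ?B\<close> card_mono[OF assms sub]
    by (simp add: card_Diff_subset del: card_insert_disjoint)
qed

lemma input_graph_G':
  assumes "input_graph G"
  shows "input_graph G'"
proof -
  have "pair_fin_digraph G'"
    using assms arcs
    by (auto simp: input_graph_def pair_fin_digraph_def pair_wf_digraph_def
      pair_fin_digraph_axioms_def G'_def)
  moreover have "parcs G' `` {a} \<noteq> {}" if "a \<in> pverts G" for a
    using assms that by (auto simp: out_G' input_graph_def)
  ultimately show ?thesis by (simp add: input_graph_def)
qed

text \<open>In the sorted lists \<open>x\<close> and \<open>u\<close> replace each other. They have
  equal out-degrees, and the swap changes no out-degree, so the sequence of sorting keys is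
  unchanged.\<close>

lemma adj_lists_of_swap:
  assumes "adj_lists_of G L" and deg: "card (parcs G `` {x}) = card (parcs G `` {u})"
  shows "adj_lists_of G' L'"
proof -
  have "out_degree (with_proj G') (swap_tail a) = out_degree (with_proj G) a"
    "out_degree (with_proj G') a = out_degree (with_proj G) a" for a
    using deg by (auto simp: out_degree_with_proj card_out_G' Transposition.transpose_def)
  then have "map (out_degree (with_proj G')) (in_sorted_list L' a)
      = map (out_degree (with_proj G)) (in_sorted_list L a)" for a
    by (simp add: L'_def)
  then show ?thesis
    using assms unfolding adj_lists_of_def
    by (auto simp: out_G' in_G' L'_def distinct_map)
qed

end

text \<open>The pair of nodes whose adjacency a query inspects, according to the original lists. For
  an index beyond the end of a list the pair is unspecified, which is harmless: both graphs then
  answer \<open>Invalid\<close>.\<close>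

fun probe :: "adj_lists \<Rightarrow> query \<Rightarrow> (nat \<times> nat) option" where
  "probe L (Out a i) = Some (a, out_list L a ! i)"
| "probe L (In a i) = Some (in_list L a ! i, a)"
| "probe L (In_Sorted a i) = Some (in_sorted_list L a ! i, a)"
| "probe L (Adj a b) = Some (a, b)"
| "probe L _ = None"

text \<open>Degrees and the node set are preserved, and a list entry changes only if its owner and
  the entry itself form a pair in \<open>{x, u} \<times> {w, v}\<close>, up to orientation.\<close>

lemma (in arc_swap) answer_query_swap:
  assumes "probe L q \<notin> Some ` ({x, u} \<times> {w, v})"
  shows "answer_query G' L' q = answer_query G L q"
proof (cases q)
  case (Deg_In a)
  then show ?thesis by (simp add: in_degree_with_proj card_in_G')
next
  case (Deg_Out a)
  then show ?thesis by (simp add: out_degree_with_proj card_out_G')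
next
  case (In a i)
  then show ?thesis using assms
    by (auto simp: list_answer_def L'_def Transposition.transpose_def)
next
  case (Out a i)
  then show ?thesis using assms
    by (auto simp: list_answer_def L'_def Transposition.transpose_def)
next
  case (In_Sorted a i)
  then show ?thesis using assms
    by (auto simp: list_answer_def L'_def Transposition.transpose_def)
next
  case (Adj a b)
  then show ?thesis using assms by (auto simp: G'_def)
next
  case Jump
  then show ?thesis by simp
qed

section \<open>From undetected swaps to expected running time\<close>

lemma nn_integral_indicator_fst_spmf:
  fixes p :: "('a \<times> nat) spmf"
  shows
  "(\<integral>\<^sup>+ r. indicator B (fst r) \<partial>measure_spmf p)
    = ennreal (measure_pmf.prob p {r. \<exists>y k. r = Some (y, k) \<and> y \<in> B})"
proof -
  have "Some ` {r :: 'a \<times> nat. fst r \<in> B} = {r. \<exists>y k. r = Some (y, k) \<and> y \<in> B}" by auto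
  moreover have "(\<integral>\<^sup>+ r. indicator B (fst r) \<partial>measure_spmf p)
      = (\<integral>\<^sup>+ r. indicator {r. fst r \<in> B} r \<partial>measure_spmf p)"
    by (intro nn_integral_cong) (simp split: split_indicator)
  moreover have "\<dots> = ennreal (measure_pmf.prob p (Some ` {r. fst r \<in> B}))"
    by (simp add: emeasure_measure_spmf_conv_measure_pmf measure_pmf.emeasure_eq_measure)
  ultimately show ?thesis by (simp only:)
qed

text \<open>A run that never halts counts as infinite on the right and is ignored on the
  left.\<close>

lemma nn_integral_snd_le_expected_time:
  "(\<integral>\<^sup>+ r. of_nat (snd r) \<partial>measure_spmf (exec_algorithm A G L t \<delta>)) \<le> expected_time A G L t \<delta>"
  unfolding expected_time_def
  by (subst nn_integral_measure_spmf_conv_measure_pmf)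
     (auto simp: nn_integral_restrict_space split: option.split split_indicator
       intro!: nn_integral_mono)

lemma exec_time_pos: "(y, k) \<in> set_spmf (exec G L c) \<Longrightarrow> 1 \<le> k"
  by (subst (asm) exec.simps) (auto simp: set_bind_spmf simp del: bind_spmf_of_pmf split: comp.splits)

text \<open>Even halting at once takes one step. This settles thresholds too large for the swaps to
  be noticeable.\<close>

lemma expected_time_ge_1: "1 \<le> expected_time A G L t \<delta>"
proof -
  let ?p = "exec_algorithm A G L t \<delta>"
  have "1 = (\<integral>\<^sup>+ r. 1 \<partial>measure_pmf ?p)" by simp
  also have "\<dots> \<le> expected_time A G L t \<delta>"
    unfolding expected_time_def
  proof (rule nn_integral_mono_AE, rule AE_pmfI)
    fix r assume "r \<in> set_pmf ?p"
    then show "1 \<le> (case r of None \<Rightarrow> \<infinity> | Some (_, k) \<Rightarrow> (of_nat k :: ennreal))"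
      using exec_time_pos[of _ _ G L "A (pverts G) (card (parcs G)) t \<delta>"]
      by (auto simp: exec_algorithm_def in_set_spmf split: option.split)
  qed
  finally show ?thesis .
qed

text \<open>The estimate for \<open>u i\<close> has to differ between \<open>G\<close> and every swap at \<open>(i, j)\<close>, while no query
  tells \<open>G\<close> apart from two of these \<open>b * k\<close> swaps.\<close>

lemma expected_time_swap_ge:
  fixes x w u v :: "nat \<Rightarrow> nat"
  assumes solves: "solves_single_target \<alpha> \<epsilon> p\<^sub>f A"
    and G: "input_graph G" and L: "adj_lists_of G L" and t: "t \<in> pverts G"
    and \<delta>: "0 < \<delta>" "\<delta> \<le> 1" and \<epsilon>: "0 < \<epsilon>" "\<epsilon> < 1" and p: "0 \<le> p\<^sub>f" "p\<^sub>f \<le> 1 / 2"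
    and swap: "\<And>i j. i < b \<Longrightarrow> j < k \<Longrightarrow> arc_swap G (x i) (w j) (u i) (v j)"
    and deg: "\<And>i. i < b \<Longrightarrow> card (parcs G `` {x i}) = card (parcs G `` {u i})"
    and inj: "inj x" "inj u" "\<And>i i'. x i \<noteq> u i'" "inj w" "inj v" "\<And>j j'. w j \<noteq> v j'"
    and zero: "\<And>i. i < b \<Longrightarrow> ppr \<alpha> G (u i) t = 0"
    and large: "\<And>i j. i < b \<Longrightarrow> j < k \<Longrightarrow>
      \<delta> \<le> (1 - \<epsilon>) * ppr \<alpha> (arc_swap.G' G (x i) (w j) (u i) (v j)) (u i) t"
  shows "ennreal ((1 - 2 * p\<^sub>f) * real (b * k)) \<le> expected_time A G L t \<delta>"
proof -
  define S where "S = {..<b} \<times> {..<k}"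
  define H where "H s = arc_swap.G' G (x (fst s)) (w (snd s)) (u (fst s)) (v (snd s))" for s :: "nat \<times> nat"
  define M where "M s = arc_swap.L' L (x (fst s)) (w (snd s)) (u (fst s)) (v (snd s))" for s :: "nat \<times> nat"
  \<comment> \<open>The estimates that are acceptable on \<open>G\<close>, where the true value at
    \<open>u (fst s)\<close> is 0 and the tolerance is \<epsilon> \<delta>.\<close>
  define B where "B s = {est :: nat \<Rightarrow> real. \<bar>est (u (fst s))\<bar> < \<epsilon> * \<delta>}" for s :: "nat \<times> nat"
  define c where "c = A (pverts G) (card (parcs G)) t \<delta>"
  let ?R = "\<lambda>s. {r. \<exists>y k. r = Some (y, k :: nat) \<and> y \<in> B s}"
  have swapS: "arc_swap G (x (fst s)) (w (snd s)) (u (fst s)) (v (snd s))" if "s \<in> S" for s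
    using that swap by (auto simp: S_def)
  have fin: "finite (parcs G)"
    using G by (auto simp: input_graph_def pair_fin_digraph_def pair_fin_digraph_axioms_def)
  have u: "u i \<in> pverts G" if "i < b" "j < k" for i j
    using arc_swap.arcs(2)[OF swap[OF that]] G
    by (auto simp: input_graph_def pair_fin_digraph_def dest: pair_wf_digraph.in_arcsD1)
  have one: "card {s\<in>S. answer_query (H s) (M s) q \<noteq> answer_query G L q} \<le> 1" for q
  proof -
    define N where "N = {s\<in>S. answer_query (H s) (M s) q \<noteq> answer_query G L q}"
    have probe: "probe L q \<in> Some ` ({x (fst s), u (fst s)} \<times> {w (snd s), v (snd s)})" if "s \<in> N" for s
      using that arc_swap.answer_query_swap[OF swapS, of s L q] by (auto simp: N_def H_def M_def)
    have "s = s'" if s: "s \<in> N" and s': "s' \<in> N" for s s'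
    proof -
      obtain e where "e \<in> {x (fst s), u (fst s)} \<times> {w (snd s), v (snd s)}"
        "e \<in> {x (fst s'), u (fst s')} \<times> {w (snd s'), v (snd s')}"
        using probe[OF s] probe[OF s'] by (elim imageE) simp
      \<comment> \<open>The first node of the common pair determines the source index and the second
        the relay index, by injectivity and disjointness of the four families.\<close>
      then have "fst s = fst s'" "snd s = snd s'"
        using inj not_sym[OF inj(3)] not_sym[OF inj(6)] by (auto simp: inj_eq)
      then show ?thesis by (simp add: prod_eq_iff)
    qed
    moreover have "finite N" by (simp add: N_def S_def)
    ultimately have "card N \<le> 1" by (auto simp: card_le_Suc0_iff_eq)
    then show ?thesis by (simp add: N_def)
  qed
  have lower: "1 - p\<^sub>f \<le> measure_pmf.prob (exec G L c) (?R s)" if s: "s \<in> S" for s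
  proof -
    let ?F = "{r. case r of None \<Rightarrow> True
      | Some (est, _) \<Rightarrow> \<bar>est (u (fst s)) - ppr \<alpha> G (u (fst s)) t\<bar> \<ge> \<epsilon> * max (ppr \<alpha> G (u (fst s)) t) \<delta>}"
    have "measure_pmf.prob (exec G L c) ?F \<le> p\<^sub>f"
      using solves G L t \<delta> s u unfolding solves_single_target_def c_def exec_algorithm_def S_def by auto
    moreover have "?R s = - ?F"
      using zero[of "fst s"] s \<delta> by (auto simp: S_def B_def split: option.splits)
    ultimately show ?thesis
      using measure_pmf.prob_compl[of ?F "exec G L c"] by (simp add: Compl_eq_Diff_UNIV)
  qed
  have upper: "measure_pmf.prob (exec (H s) (M s) c) (?R s) \<le> p\<^sub>f" if s: "s \<in> S" for s
  proof -
    interpret arc_swap G L "x (fst s)" "w (snd s)" "u (fst s)" "v (snd s)"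
      using swapS[OF s] by (simp add: arc_swap_def)
    have H: "H s = G'" and M: "M s = L'" by (simp_all add: H_def M_def)
    let ?\<pi> = "ppr \<alpha> (H s) (u (fst s)) t"
    let ?F = "{r. case r of None \<Rightarrow> True
      | Some (est, _) \<Rightarrow> \<bar>est (u (fst s)) - ?\<pi>\<bar> \<ge> \<epsilon> * max ?\<pi> \<delta>}"
    have "input_graph (H s)" "adj_lists_of (H s) (M s)" "t \<in> pverts (H s)" "u (fst s) \<in> pverts (H s)"
      using input_graph_G'[OF G] adj_lists_of_swap[OF L] deg s t u by (auto simp: H M S_def)
    then have "measure_pmf.prob (exec_algorithm A (H s) (M s) t \<delta>) ?F \<le> p\<^sub>f"
      using solves \<delta> unfolding solves_single_target_def by blast
    moreover have "exec_algorithm A (H s) (M s) t \<delta> = exec (H s) (M s) c"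
      by (simp add: exec_algorithm_def c_def H card_parcs_G'[OF fin])
    \<comment> \<open>Write \<pi> for the value after the swap. An estimate below \<epsilon>
      \<delta> in absolute value errs by more than \<pi> - \<epsilon> \<delta>, and \<epsilon>
      \<delta> \<le> \<delta> \<le> (1 - \<epsilon>) \<pi> makes this at least \<epsilon> \<pi>.
      Moreover \<delta> \<le> \<pi>, so the maximum in the error bound is \<pi>.\<close>
    moreover have "?R s \<subseteq> ?F"
    proof -
      have \<pi>: "\<delta> \<le> (1 - \<epsilon>) * ?\<pi>" using large s by (auto simp: S_def H_def)
      then have "0 \<le> ?\<pi>" by (simp add: ppr_nonneg)
      have "\<delta> \<le> ?\<pi>" using \<pi> mult_nonneg_nonneg[OF less_imp_le[OF \<epsilon>(1)] \<open>0 \<le> ?\<pi>\<close>]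
        by (simp add: algebra_simps)
      moreover have "\<epsilon> * \<delta> \<le> \<delta>" using \<epsilon> \<delta> by simp
      ultimately show ?thesis
        using \<pi> by (auto simp: B_def max_def algebra_simps)
    qed
    ultimately show ?thesis
      using measure_pmf.finite_measure_mono[of "?R s" ?F "exec (H s) (M s) c"] by simp
  qed
  let ?T = "\<integral>\<^sup>+ r. of_nat (snd r) \<partial>measure_spmf (exec G L c)"
  have "ennreal (real (b * k) * (1 - p\<^sub>f)) = (\<Sum>s\<in>S. ennreal (1 - p\<^sub>f))"
    using p by (subst sum_ennreal) (auto simp: S_def)
  also have "\<dots> \<le> (\<Sum>s\<in>S. ennreal (measure_pmf.prob (exec G L c) (?R s)))"
    using lower by (intro sum_mono ennreal_leI)
  also have "\<dots> \<le> (\<Sum>s\<in>S. ennreal (measure_pmf.prob (exec (H s) (M s) c) (?R s))) + ?T"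
    using exec_distinguish[of S H M G L c B] one
    by (simp add: nn_integral_indicator_fst_spmf S_def)
  also have "\<dots> \<le> (\<Sum>s\<in>S. ennreal p\<^sub>f) + ?T"
    using upper by (intro add_right_mono sum_mono ennreal_leI)
  also have "(\<Sum>s\<in>S. ennreal p\<^sub>f) = ennreal (real (b * k) * p\<^sub>f)"
    using p by (subst sum_ennreal) (auto simp: S_def)
  finally have "ennreal (real (b * k) * (1 - p\<^sub>f)) \<le> ennreal (real (b * k) * p\<^sub>f) + ?T" .
  then have "ennreal (real (b * k) * (1 - p\<^sub>f)) - ennreal (real (b * k) * p\<^sub>f) \<le> ?T"
    by (simp add: ennreal_minus_le_iff)
  then have "ennreal (real (b * k) * (1 - p\<^sub>f) - real (b * k) * p\<^sub>f) \<le> ?T"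
    using p by (simp add: ennreal_minus)
  also have "real (b * k) * (1 - p\<^sub>f) - real (b * k) * p\<^sub>f = (1 - 2 * p\<^sub>f) * real (b * k)"
    by (simp add: algebra_simps)
  also have "?T \<le> expected_time A G L t \<delta>"
    using nn_integral_snd_le_expected_time[of A G L t \<delta>] by (simp add: exec_algorithm_def c_def)
  finally show ?thesis .
qed

lemma average_expected_time_ge:
  assumes "finite (pverts G)" "T \<subseteq> pverts G" "0 \<le> e"
    and "\<And>t. t \<in> T \<Longrightarrow> ennreal e \<le> expected_time A G L t \<delta>"
  shows "ennreal (e * card T / card (pverts G)) \<le> average_expected_time A G L \<delta>"
proof (cases "pverts G = {}")
  case True
  then show ?thesis by simp
next
  case False
  have "ennreal (e * card T) = (\<Sum>t\<in>T. ennreal e)"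
    using assms by (subst sum_ennreal) (auto simp: mult.commute)
  also have "\<dots> \<le> (\<Sum>t\<in>T. expected_time A G L t \<delta>)"
    using assms by (intro sum_mono)
  also have "\<dots> \<le> (\<Sum>t\<in>pverts G. expected_time A G L t \<delta>)"
    using assms by (intro sum_mono2) auto
  finally have "ennreal (e * card T) / of_nat (card (pverts G)) \<le> average_expected_time A G L \<delta>"
    unfolding average_expected_time_def by (rule divide_right_mono_ennreal)
  moreover have "ennreal (e * card T) / of_nat (card (pverts G)) = ennreal (e * card T / card (pverts G))"
    using False assms
    by (simp add: ennreal_of_nat_eq_real_of_nat divide_ennreal card_gt_0_iff)
  ultimately show ?thesis by simp
qed

section \<open>The family of hard graphs\<close>

text \<open>The targets \<open>Tgt g i\<close> of a group \<open>g\<close> are reached exactly from the sources \<open>Src g i\<close> through the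
  relays \<open>Mid g j\<close>.  The sources \<open>Src' i\<close> lead to the dead ends \<open>Mid' j\<close> instead.\<close>

datatype node = Src nat nat | Mid nat nat | Tgt nat nat | Src' nat | Mid' nat | Pad nat

instance node :: countable
  by countable_datatype

definition nodes :: "nat \<Rightarrow> nat \<Rightarrow> nat \<Rightarrow> nat \<Rightarrow> node set" where
  "nodes r b k n =
     case_prod Src ` ({..<r} \<times> {..<b}) \<union> case_prod Mid ` ({..<r} \<times> {..<k}) \<union>
     case_prod Tgt ` ({..<r} \<times> {..<b}) \<union> Src' ` {..<b} \<union> Mid' ` {..<k} \<union> Pad ` {..<n}"

text \<open>The loops give targets and dead ends an out-neighbor and trap the walk there. The
  relation \<open>F\<close> on the \<open>Pad\<close> nodes serves to bring the number of edges up
  to \<open>m\<close>.\<close>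

definition edges :: "nat \<Rightarrow> nat \<Rightarrow> nat \<Rightarrow> (nat \<times> nat) set \<Rightarrow> (node \<times> node) set" where
  "edges r b k F =
     (\<lambda>(g, i, j). (Src g i, Mid g j)) ` ({..<r} \<times> {..<b} \<times> {..<k}) \<union>
     (\<lambda>(g, i, j). (Mid g j, Tgt g i)) ` ({..<r} \<times> {..<b} \<times> {..<k}) \<union>
     (\<lambda>(g, i). (Tgt g i, Tgt g i)) ` ({..<r} \<times> {..<b}) \<union>
     (\<lambda>(i, j). (Src' i, Mid' j)) ` ({..<b} \<times> {..<k}) \<union>
     (\<lambda>j. (Mid' j, Mid' j)) ` {..<k} \<union> (\<lambda>(i, j). (Pad i, Pad j)) ` F"

text \<open>Input graphs have natural numbers as nodes, so the structured nodes are encoded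
  injectively by \<open>to_nat\<close>.\<close>

definition hard_graph :: "nat \<Rightarrow> nat \<Rightarrow> nat \<Rightarrow> nat \<Rightarrow> (nat \<times> nat) set \<Rightarrow> nat pair_pre_digraph" where
  "hard_graph r b k n F =
     \<lparr>pverts = to_nat ` nodes r b k n, parcs = map_prod to_nat to_nat ` edges r b k F\<rparr>"

lemma finite_nodes: "finite (nodes r b k n)"
  by (simp add: nodes_def)

lemma finite_edges: "finite F \<Longrightarrow> finite (edges r b k F)"
  by (simp add: edges_def)

lemma card_nodes_le: "card (nodes r b k n) \<le> r * b + r * k + r * b + b + k + n"
  unfolding nodes_def
  by (intro card_Un_le[THEN order_trans] add_mono card_image_le[THEN order_trans]) auto

lemma card_nodes_ge: "n \<le> card (nodes r b k n)"
proof -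
  have "card (Pad ` {..<n}) \<le> card (nodes r b k n)"
    by (intro card_mono finite_nodes) (auto simp: nodes_def)
  then show ?thesis by (simp add: card_image inj_on_def)
qed

lemma card_edges_le:
  assumes "finite F"
  shows "card (edges r b k F) \<le> r * b * k + r * b * k + r * b + b * k + k + card F"
  unfolding edges_def
  by (intro card_Un_le[THEN order_trans] add_mono card_image_le[THEN order_trans])
     (auto simp: assms)

lemma card_edges_ge:
  assumes "finite F"
  shows "card F \<le> card (edges r b k F)"
proof -
  have "card ((\<lambda>(i, j). (Pad i, Pad j)) ` F) \<le> card (edges r b k F)"
    by (intro card_mono finite_edges assms) (auto simp: edges_def)
  moreover have "inj_on (\<lambda>(i, j). (Pad i, Pad j)) F" by (auto simp: inj_on_def)
  ultimately show ?thesis by (simp add: card_image)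
qed

lemma card_pverts_hard_graph: "card (pverts (hard_graph r b k n F)) = card (nodes r b k n)"
  by (simp add: hard_graph_def card_image)

lemma card_parcs_hard_graph: "card (parcs (hard_graph r b k n F)) = card (edges r b k F)"
  by (simp add: hard_graph_def card_image prod.inj_map inj_on_subset[OF prod.inj_map])

lemma parcs_hard_graph_iff:
  "(to_nat a, to_nat c) \<in> parcs (hard_graph r b k n F) \<longleftrightarrow> (a, c) \<in> edges r b k F"
  by (auto simp: hard_graph_def)

lemma Image_hard_graph:
  "parcs (hard_graph r b k n F) `` {to_nat a} = to_nat ` (edges r b k F `` {a})"
  by (force simp: hard_graph_def)

lemma edges_iff:
  "(Src g i, c) \<in> edges r b k F \<longleftrightarrow> g < r \<and> i < b \<and> c \<in> Mid g ` {..<k}"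
  "(Mid g j, c) \<in> edges r b k F \<longleftrightarrow> g < r \<and> j < k \<and> c \<in> Tgt g ` {..<b}"
  "(Tgt g i, c) \<in> edges r b k F \<longleftrightarrow> g < r \<and> i < b \<and> c = Tgt g i"
  "(Src' i, c) \<in> edges r b k F \<longleftrightarrow> i < b \<and> c \<in> Mid' ` {..<k}"
  "(Mid' j, c) \<in> edges r b k F \<longleftrightarrow> j < k \<and> c = Mid' j"
  "(Pad l, c) \<in> edges r b k F \<longleftrightarrow> c \<in> Pad ` (F `` {l})"
  by (auto simp: edges_def image_iff intro: rev_bexI)

lemma edges_Image:
  "g < r \<Longrightarrow> i < b \<Longrightarrow> edges r b k F `` {Src g i} = Mid g ` {..<k}"
  "g < r \<Longrightarrow> j < k \<Longrightarrow> edges r b k F `` {Mid g j} = Tgt g ` {..<b}"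
  "g < r \<Longrightarrow> i < b \<Longrightarrow> edges r b k F `` {Tgt g i} = {Tgt g i}"
  "i < b \<Longrightarrow> edges r b k F `` {Src' i} = Mid' ` {..<k}"
  "j < k \<Longrightarrow> edges r b k F `` {Mid' j} = {Mid' j}"
  "edges r b k F `` {Pad l} = Pad ` (F `` {l})"
  by (simp_all add: set_eq_iff edges_iff)

lemma edges_Image_nonempty:
  assumes "0 < b" "0 < k" "Id_on {..<n} \<subseteq> F" "a \<in> nodes r b k n"
  shows "edges r b k F `` {a} \<noteq> {}"
proof -
  have "F `` {i} \<noteq> {}" if "i < n" for i
    using assms(3) that by blast
  then show ?thesis
    using assms(1,2,4) by (auto simp: nodes_def edges_Image simp del: Image_singleton_iff)
qed

lemma input_graph_hard_graph:
  assumes "0 < b" "0 < k" "Id_on {..<n} \<subseteq> F" "F \<subseteq> {..<n} \<times> {..<n}"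
  shows "input_graph (hard_graph r b k n F)"
proof -
  have "finite F" using assms(4) finite_subset by blast
  have "edges r b k F \<subseteq> nodes r b k n \<times> nodes r b k n"
    using assms(4) by (auto simp: edges_def nodes_def)
  then have "pair_fin_digraph (hard_graph r b k n F)"
    using finite_nodes finite_edges[OF \<open>finite F\<close>]
    by (auto simp: hard_graph_def pair_fin_digraph_def pair_wf_digraph_def
        pair_fin_digraph_axioms_def)
  moreover have "parcs (hard_graph r b k n F) `` {a} \<noteq> {}" if "a \<in> pverts (hard_graph r b k n F)" for a
    using that edges_Image_nonempty[OF assms(1-3)]
    by (auto simp: Image_hard_graph hard_graph_def[of r b k n F, THEN arg_cong[where f=pverts]]
        simp del: Image_singleton_iff)
  ultimately show ?thesis by (simp add: input_graph_def)
qed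

lemma arc_swap_hard_graph:
  assumes "g < r" "i < b" "j < k"
  shows "arc_swap (hard_graph r b k n F)
    (to_nat (Src g i)) (to_nat (Mid g j)) (to_nat (Src' i)) (to_nat (Mid' j))"
  using assms by unfold_locales (auto simp: parcs_hard_graph_iff edges_iff)

text \<open>From \<open>Src' i\<close> the walk can only move to some \<open>Mid' j\<close>, where
  the loop holds it forever.\<close>

lemma ppr_hard_graph_eq_0:
  assumes "0 < \<alpha>" "\<alpha> \<le> 1" "i < b" "0 < k"
  shows "ppr \<alpha> (hard_graph r b k n F) (to_nat (Src' i)) (to_nat (Tgt g l)) = 0"
proof -
  let ?G = "hard_graph r b k n F"
  have "ppr \<alpha> ?G (to_nat (Mid' j)) (to_nat (Tgt g l)) = 0" if "j < k" for j
    using assms that by (intro ppr_loop_eq_0) (auto simp: Image_hard_graph edges_Image)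
  then show ?thesis
    using assms by (subst ppr_unfold) (auto simp: Image_hard_graph edges_Image intro!: sum.neutral)
qed

text \<open>The swap opens the path from \<open>Src' i\<close> through \<open>Mid g j\<close> to
  every target of group \<open>g\<close>. Its two moves have probabilities (1 - \<alpha>) / k and (1
  - \<alpha>) / b since out-degrees are preserved, and stopping at the target contributes
  \<alpha>.\<close>

lemma ppr_swapped_hard_graph_ge:
  fixes \<alpha> :: real
  assumes \<alpha>: "0 < \<alpha>" "\<alpha> < 1" and idx: "g < r" "i < b" "j < k" "l < b"
    and F: "Id_on {..<n} \<subseteq> F" "F \<subseteq> {..<n} \<times> {..<n}"
  defines "H \<equiv> arc_swap.G' (hard_graph r b k n F)
    (to_nat (Src g i)) (to_nat (Mid g j)) (to_nat (Src' i)) (to_nat (Mid' j))"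
  shows "\<alpha> * (1 - \<alpha>)\<^sup>2 / (b * k) \<le> ppr \<alpha> H (to_nat (Src' i)) (to_nat (Tgt g l))"
proof -
  let ?G = "hard_graph r b k n F"
  interpret arc_swap ?G undefined "to_nat (Src g i)" "to_nat (Mid g j)" "to_nat (Src' i)" "to_nat (Mid' j)"
    using idx by (intro arc_swap_hard_graph)
  have "input_graph H"
    unfolding H_def using idx F by (intro input_graph_G' input_graph_hard_graph) auto
  then have "finite (parcs H)"
    by (auto simp: input_graph_def pair_fin_digraph_def pair_fin_digraph_axioms_def)
  then have fin: "finite (parcs H `` {a})" for a by (rule finite_Image)
  have out: "card (parcs H `` {to_nat a}) = card (edges r b k F `` {a})" for a
    unfolding H_def by (simp add: card_out_G' Image_hard_graph card_image)
  have same: "(to_nat a, c) \<in> parcs H" if "(to_nat a, c) \<in> parcs ?G" "a \<noteq> Src g i" "a \<noteq> Src' i" for a c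
    using that by (auto simp: H_def G'_def)
  have arc1: "(to_nat (Src' i), to_nat (Mid g j)) \<in> parcs H"
    by (simp add: H_def G'_def)
  have arc2: "(to_nat (Mid g j), to_nat (Tgt g l)) \<in> parcs H"
    using idx by (intro same) (auto simp: parcs_hard_graph_iff edges_iff)
  have arc3: "(to_nat (Tgt g l), to_nat (Tgt g l)) \<in> parcs H"
    using idx by (intro same) (auto simp: parcs_hard_graph_iff edges_iff)
  have c1: "card (parcs H `` {to_nat (Src' i)}) = k" and c2: "card (parcs H `` {to_nat (Mid g j)}) = b"
    using idx by (simp_all add: out edges_Image card_image inj_on_def)
  have "\<alpha> \<le> ppr \<alpha> H (to_nat (Tgt g l)) (to_nat (Tgt g l))"
    using \<alpha> fin arc3 by (intro ppr_self_ge) auto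
  then have "(1 - \<alpha>) * \<alpha> / b \<le> (1 - \<alpha>) * ppr \<alpha> H (to_nat (Tgt g l)) (to_nat (Tgt g l)) / b"
    using \<alpha> by (intro divide_right_mono mult_left_mono) auto
  also have "\<dots> \<le> ppr \<alpha> H (to_nat (Mid g j)) (to_nat (Tgt g l))"
    using \<alpha> fin arc2 ppr_step_ge[of \<alpha> H "to_nat (Mid g j)"] by (simp add: c2)
  finally have "(1 - \<alpha>) * ((1 - \<alpha>) * \<alpha> / b) / k
      \<le> (1 - \<alpha>) * ppr \<alpha> H (to_nat (Mid g j)) (to_nat (Tgt g l)) / k"
    using \<alpha> by (intro divide_right_mono mult_left_mono) auto
  also have "\<dots> \<le> ppr \<alpha> H (to_nat (Src' i)) (to_nat (Tgt g l))"
    using \<alpha> fin arc1 ppr_step_ge[of \<alpha> H "to_nat (Src' i)"] by (simp add: c1)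
  finally show ?thesis by (simp add: power2_eq_square mult_ac)
qed

section \<open>Lower bound on hard graphs and choice of their size\<close>

lemma expected_time_hard_graph_ge:
  fixes \<alpha> \<epsilon> \<delta> p\<^sub>f :: real
  assumes \<alpha>: "0 < \<alpha>" "\<alpha> < 1" and \<epsilon>: "0 < \<epsilon>" "\<epsilon> < 1" and p: "0 \<le> p\<^sub>f" "p\<^sub>f \<le> 1 / 2"
    and \<delta>: "0 < \<delta>" "\<delta> \<le> 1" and idx: "g < r" "l < b" "0 < k"
    and F: "Id_on {..<n} \<subseteq> F" "F \<subseteq> {..<n} \<times> {..<n}"
    and bk: "b * k \<le> \<alpha> * (1 - \<alpha>)\<^sup>2 * (1 - \<epsilon>) / \<delta>"
    and A: "solves_single_target \<alpha> \<epsilon> p\<^sub>f A" and L: "adj_lists_of (hard_graph r b k n F) L"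
  shows "ennreal ((1 - 2 * p\<^sub>f) * real (b * k))
    \<le> expected_time A (hard_graph r b k n F) L (to_nat (Tgt g l)) \<delta>"
proof (rule expected_time_swap_ge[OF A _ L _ \<delta> \<epsilon> p,
    where x = "\<lambda>i. to_nat (Src g i)" and w = "\<lambda>j. to_nat (Mid g j)"
      and u = "\<lambda>i. to_nat (Src' i)" and v = "\<lambda>j. to_nat (Mid' j)"])
  show "input_graph (hard_graph r b k n F)"
    using idx F by (intro input_graph_hard_graph) auto
  show "to_nat (Tgt g l) \<in> pverts (hard_graph r b k n F)"
    using idx by (auto simp: hard_graph_def nodes_def)
  fix i assume i: "i < b"
  show "card (parcs (hard_graph r b k n F) `` {to_nat (Src g i)})
      = card (parcs (hard_graph r b k n F) `` {to_nat (Src' i)})"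
    using idx i by (simp add: Image_hard_graph edges_Image card_image inj_on_def)
  show "ppr \<alpha> (hard_graph r b k n F) (to_nat (Src' i)) (to_nat (Tgt g l)) = 0"
    using \<alpha> idx i by (intro ppr_hard_graph_eq_0) auto
  fix j assume j: "j < k"
  show "arc_swap (hard_graph r b k n F)
      (to_nat (Src g i)) (to_nat (Mid g j)) (to_nat (Src' i)) (to_nat (Mid' j))"
    using idx i j by (intro arc_swap_hard_graph)
  \<comment> \<open>The bound on \<open>b * k\<close> says precisely that the path opened by the
    swap is likely enough to be noticed at threshold \<delta>.\<close>
  have "\<delta> \<le> (1 - \<epsilon>) * (\<alpha> * (1 - \<alpha>)\<^sup>2 / (b * k))"
    using bk \<delta> i j by (simp add: field_simps)
  also have "\<dots> \<le> (1 - \<epsilon>) * ppr \<alpha> (arc_swap.G' (hard_graph r b k n F)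
      (to_nat (Src g i)) (to_nat (Mid g j)) (to_nat (Src' i)) (to_nat (Mid' j)))
      (to_nat (Src' i)) (to_nat (Tgt g l))"
    using \<alpha> \<epsilon> idx i j F by (intro mult_left_mono ppr_swapped_hard_graph_ge) auto
  finally show "\<delta> \<le> \<dots>" .
qed (auto simp: inj_def)

text \<open>\<open>Q\<close> is the desired size of \<open>b * k\<close>. If
  \<open>Q \<le> n\<close>, about \<open>n / Q\<close> groups with a single relay each are used;
  otherwise one group with \<open>n\<close> sources and about \<open>Q / n\<close> relays. Either
  way there are at least \<open>n / 2\<close> targets, and rounding costs a factor of at most
  2.\<close>

lemma hard_graph_parameters:
  fixes n m Q :: nat
  assumes "1 \<le> n" "n \<le> m" "m \<le> n\<^sup>2" "1 \<le> Q" "Q \<le> m"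
  obtains r b k :: nat where "0 < r" "0 < b" "0 < k" "b * k \<le> Q" "Q \<le> 2 * (b * k)"
    "n \<le> 2 * (r * b)" "r * b + r * k + r * b + b + k + n \<le> 6 * n"
    "r * b * k + r * b * k + r * b + b * k + k + m \<le> 6 * m"
proof (cases "Q \<le> n")
  case True
  define R where "R = n div Q"
  have "0 < R" using True assms(4) by (simp add: R_def div_greater_zero_iff)
  then have "Q \<le> R * Q" by simp
  moreover have "n = R * Q + n mod Q" "n mod Q < Q" using assms(4) by (simp_all add: R_def)
  ultimately have "n \<le> 2 * (R * Q)" "R * Q \<le> n" by linarith+
  moreover have "R \<le> n" by (simp add: R_def)
  ultimately show ?thesis
    using that[of R Q 1] \<open>0 < R\<close> True assms(1,2,4) by simp
next
  case False
  define K where "K = Q div n"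
  have "Q \<le> n * n" using assms by (simp add: power2_eq_square)
  \<comment> \<open>This is where \<open>m \<le> n\<^sup>2\<close> enters: it keeps the number of
    relays within \<open>n\<close>.\<close>
  then have "K \<le> n * n div n" unfolding K_def by (rule div_le_mono)
  then have "K \<le> n" using assms(1) by simp
  have "0 < K" using False assms(1) by (simp add: K_def div_greater_zero_iff)
  then have "n \<le> n * K" by simp
  moreover have "Q = n * K + Q mod n" "Q mod n < n" using assms(1) by (simp_all add: K_def)
  ultimately have "n * K \<le> Q" "Q \<le> 2 * (n * K)" by linarith+
  then show ?thesis
    using that[of 1 n K] \<open>0 < K\<close> \<open>K \<le> n\<close> assms(1,2,5) by simp
qed

theorem theorem5p8:
  fixes \<alpha> \<epsilon> p\<^sub>f :: real
  assumes "0 < \<alpha>" "\<alpha> < 1" "0 < \<epsilon>" "\<epsilon> < 1" "0 < p\<^sub>f" "p\<^sub>f < 1 / 2"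
  shows "\<exists>c\<^sub>1 > 0. \<exists>c\<^sub>2 > 0. \<exists>c > 0. \<forall>(n::nat) (m::nat) (\<delta>::real).
    1 \<le> n \<and> n \<le> m \<and> m \<le> n\<^sup>2 \<and> 0 < \<delta> \<and> \<delta> \<le> 1 \<longrightarrow>
    (\<exists>G. input_graph G \<and>
         c\<^sub>1 * real n \<le> real (card (pverts G)) \<and> real (card (pverts G)) \<le> c\<^sub>2 * real n \<and>
         c\<^sub>1 * real m \<le> real (card (parcs G)) \<and> real (card (parcs G)) \<le> c\<^sub>2 * real m \<and>
         (\<forall>A. solves_single_target \<alpha> \<epsilon> p\<^sub>f A \<longrightarrow>
            (\<forall>L. adj_lists_of G L \<longrightarrow>
               average_expected_time A G L \<delta> \<ge> ennreal (c * min (real m) (1 / \<delta>)))))"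
proof -
  define \<kappa> where "\<kappa> = \<alpha> * (1 - \<alpha>)\<^sup>2 * (1 - \<epsilon>)"
  \<comment> \<open>The constant 48 is 4 times 12. Rounding to \<open>Q\<close> and passing from
    \<open>Q\<close> to \<open>b * k\<close> lose a factor 2 each; at least \<open>n / 2\<close> of
    at most \<open>6 * n\<close> nodes are targets with the lower bound, which loses 12.\<close>
  define c where "c = (1 - 2 * p\<^sub>f) * \<kappa> / 48"
  have "0 < \<kappa>" using assms by (simp add: \<kappa>_def)
  have "\<kappa> \<le> 1"
    unfolding \<kappa>_def using assms by (intro mult_le_one power_le_one) auto
  have "0 < c" using assms \<open>0 < \<kappa>\<close> by (simp add: c_def)
  have "c \<le> \<kappa>" using assms \<open>0 < \<kappa>\<close> by (simp add: c_def field_simps)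
  have "\<exists>G. input_graph G \<and>
         1 * real n \<le> real (card (pverts G)) \<and> real (card (pverts G)) \<le> 6 * real n \<and>
         1 * real m \<le> real (card (parcs G)) \<and> real (card (parcs G)) \<le> 6 * real m \<and>
         (\<forall>A. solves_single_target \<alpha> \<epsilon> p\<^sub>f A \<longrightarrow>
            (\<forall>L. adj_lists_of G L \<longrightarrow>
               average_expected_time A G L \<delta> \<ge> ennreal (c * min (real m) (1 / \<delta>))))"
    if nm: "1 \<le> n" "n \<le> m" "m \<le> n\<^sup>2" and \<delta>: "0 < \<delta>" "\<delta> \<le> 1" for n m :: nat and \<delta> :: real
  proof -
    define D where "D = min (real m) (1 / \<delta>)"
    \<comment> \<open>The largest integer allowed both by the edge budget and by the visibility of a
      swap. It is raised to 1 so that the graph exists also when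
      \<open>\<kappa> / \<delta> < 1\<close>.\<close>
    define Q where "Q = max 1 (nat \<lfloor>min (real m) (\<kappa> / \<delta>)\<rfloor>)"
    have "nat \<lfloor>min (real m) (\<kappa> / \<delta>)\<rfloor> \<le> m"
      using floor_mono[of "min (real m) (\<kappa> / \<delta>)" "real m"] by simp
    then have Q: "1 \<le> Q" "Q \<le> m" using nm by (auto simp: Q_def)
    obtain r b k where par: "0 < r" "0 < b" "0 < k" "b * k \<le> Q" "Q \<le> 2 * (b * k)"
        "n \<le> 2 * (r * b)"
      and size: "r * b + r * k + r * b + b + k + n \<le> 6 * n"
        "r * b * k + r * b * k + r * b + b * k + k + m \<le> 6 * m"
      using hard_graph_parameters[OF nm Q] by blast
    \<comment> \<open>The padding relation is chosen with exactly \<open>m\<close> pairs between the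
      diagonal, which gives every \<open>Pad\<close> node an out-neighbor, and the full square;
      \<open>n \<le> m \<le> n\<^sup>2\<close> leaves room for it.\<close>
    have "Id_on {..<n} = (\<lambda>i. (i, i)) ` {..<n}" by auto
    then have "card (Id_on {..<n}) = n" by (simp add: card_image inj_on_def)
    then obtain F where F: "Id_on {..<n} \<subseteq> F" "F \<subseteq> {..<n} \<times> {..<n}" "card F = m"
      using exists_subset_between[of "Id_on {..<n}" m "{..<n} \<times> {..<n}"] nm
      by (auto simp: power2_eq_square)
    then have finF: "finite F" using finite_subset by blast
    define G where "G = hard_graph r b k n F"
    define T where "T = to_nat ` case_prod Tgt ` ({..<r} \<times> {..<b})"
    have G: "input_graph G"
      unfolding G_def using par F by (intro input_graph_hard_graph)
    have verts: "n \<le> card (pverts G)" "card (pverts G) \<le> 6 * n"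
      using card_nodes_ge[of n r b k] card_nodes_le[of r b k n] size
      by (simp_all add: G_def card_pverts_hard_graph)
    have parcs: "m \<le> card (parcs G)" "card (parcs G) \<le> 6 * m"
      using card_edges_ge[OF finF, of r b k] card_edges_le[OF finF, of r b k] size F
      by (simp_all add: G_def card_parcs_hard_graph)
    have finV: "finite (pverts G)" by (simp add: G_def hard_graph_def finite_nodes)
    have T: "T \<subseteq> pverts G" by (auto simp: T_def G_def hard_graph_def nodes_def)
    have "inj_on (case_prod Tgt) ({..<r} \<times> {..<b})" by (auto simp: inj_on_def)
    then have "card T = r * b" by (simp add: T_def card_image)
    have "ennreal (c * D) \<le> average_expected_time A G L \<delta>"
      if A: "solves_single_target \<alpha> \<epsilon> p\<^sub>f A" and L: "adj_lists_of G L" for A L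
    proof (cases "\<kappa> / \<delta> < 1")
      case True
      \<comment> \<open>Here the claimed bound is below 1, so the single step that every run takes
        suffices.\<close>
      have "c * D \<le> \<kappa> * (1 / \<delta>)"
        using \<open>c \<le> \<kappa>\<close> \<open>0 < c\<close> \<open>0 < \<kappa>\<close> \<delta> by (intro mult_mono) (auto simp: D_def)
      then have "c * D \<le> 1" using True by simp
      then have "ennreal (c * D) \<le> ennreal (1 * real (card (pverts G)) / card (pverts G))"
        using verts nm by (intro ennreal_leI) auto
      also have "\<dots> \<le> average_expected_time A G L \<delta>"
        using finV by (intro average_expected_time_ge) (auto simp: expected_time_ge_1)
      finally show ?thesis .
    next
      case False
      let ?y = "min (real m) (\<kappa> / \<delta>)"
      have "1 \<le> ?y" using False nm by auto
      then have QD: "Q = nat \<lfloor>?y\<rfloor>" by (simp add: Q_def le_nat_iff le_floor_iff max_def)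
      then have "real Q = of_int \<lfloor>?y\<rfloor>" using \<open>1 \<le> ?y\<close> by simp
      then have "real Q \<le> ?y" "?y < real Q + 1" by linarith+
      \<comment> \<open>Rounding down a number that is at least 1 loses at most a factor 2.\<close>
      then have "?y \<le> 2 * real Q" using Q by linarith
      have "\<kappa> * real m \<le> real m"
        using \<open>0 < \<kappa>\<close> \<open>\<kappa> \<le> 1\<close> by (intro mult_left_le_one_le) auto
      then have "\<kappa> * D \<le> ?y"
        using \<open>0 < \<kappa>\<close> by (simp add: D_def min_mult_distrib_left min.coboundedI1)
      have "real (b * k) \<le> real Q" using par by (intro of_nat_mono)
      then have bk: "real (b * k) \<le> \<kappa> / \<delta>" using \<open>real Q \<le> ?y\<close> by linarith
      have "real Q \<le> 2 * real (b * k)" using par by linarith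
      then have Dbk: "\<kappa> * D \<le> 4 * real (b * k)"
        using \<open>\<kappa> * D \<le> ?y\<close> \<open>?y \<le> 2 * real Q\<close> by linarith
      have "real (card (pverts G)) \<le> 12 * real (card T)"
        using verts par \<open>card T = r * b\<close> by linarith
      then have "1 / 12 \<le> real (card T) / card (pverts G)"
        using verts nm by (simp add: field_simps)
      then have "(1 - 2 * p\<^sub>f) * real (b * k) * (1 / 12)
          \<le> (1 - 2 * p\<^sub>f) * real (b * k) * (real (card T) / card (pverts G))"
        using assms by (intro mult_left_mono) auto
      moreover have "c * D \<le> (1 - 2 * p\<^sub>f) * real (b * k) * (1 / 12)"
      proof -
        have "c * D = (1 - 2 * p\<^sub>f) / 48 * (\<kappa> * D)" by (simp add: c_def)
        also have "\<dots> \<le> (1 - 2 * p\<^sub>f) / 48 * (4 * real (b * k))"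
          using assms by (intro mult_left_mono Dbk) auto
        also have "\<dots> = (1 - 2 * p\<^sub>f) * real (b * k) * (1 / 12)" by (simp add: field_simps)
        finally show ?thesis .
      qed
      ultimately have "ennreal (c * D) \<le> ennreal ((1 - 2 * p\<^sub>f) * real (b * k) * card T / card (pverts G))"
        by (intro ennreal_leI) (simp only: times_divide_eq_right)
      also have "\<dots> \<le> average_expected_time A G L \<delta>"
      proof (rule average_expected_time_ge[OF finV T])
        fix t assume "t \<in> T"
        then obtain g l where "t = to_nat (Tgt g l)" "g < r" "l < b" by (auto simp: T_def)
        then show "ennreal ((1 - 2 * p\<^sub>f) * real (b * k)) \<le> expected_time A G L t \<delta>"
          using expected_time_hard_graph_ge[of \<alpha> \<epsilon> p\<^sub>f \<delta> g r l b k n F A L] assms \<delta> par F bk A L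
          by (simp add: G_def \<kappa>_def)
      qed (use assms in simp)
      finally show ?thesis .
    qed
    then show ?thesis
      using G verts parcs by (intro exI[of _ G]) (auto simp: D_def)
  qed
  then show ?thesis
    using \<open>0 < c\<close> by (intro exI[of _ 1] exI[of _ 6] exI[of _ c] conjI) auto
qed

end
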